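(* In the setting described in the context (a monocular camera, a stationary object with feature $s_i$, a stationary goal, the trackable-feature, goal-location, intrinsic-matrix and sufficient-excitation assumptions), suppose that the distance estimates $\hat d_c^{s_i}$, $\hat d_c^{g}$, $\hat d_g^{s_i}$ are generated by the update laws $$\dot{\hat d}_c^{s_i}(t)=\begin{cases}\eta_{s_i,1}(t), & t<\tau,\\ \eta_{s_i,1}(t)+\kappa_1\big(\nu_{s_i,1}(t)-\hat d_c^{s_i}(t)\big), & t\ge\tau,\end{cases}$$ $$\dot{\hat d}_c^{g}(t)=\begin{cases}\eta_{s_i,2}(t), & t<\tau,\\ \eta_{s_i,2}(t)+\kappa_2\big(\nu_{s_i,2}(t)-\hat d_c^{g}(t)\big), & t\ge\tau,\end{cases}$$ $$\dot{\hat d}_g^{s_i}(t)=\begin{cases}0, & t<\tau,\\ \kappa_3\big(\Sigma_{\mathcal Y_{s_i}}^{-1}(t)\Sigma_{\mathcal U_{s_i}}(t)-\hat d_g^{s_i}(t)\big), & t\ge\tau,\end{cases}$$ with arbitrary gains $\kappa_1,\kappa_2,\kappa_3>0$ and arbitrary initial estimates. Let $$\tilde\vartheta(t)=\begin{bmatrix} d_c^{s_i}(t)-\hat d_c^{s_i}(t) & d_c^{g}(t)-\hat d_c^{g}(t) & d_g^{s_i}-\hat d_g^{s_i}(t)\end{bmatrix}^\top .$$ Then the origin of the observer error system (the system of differential equations satisfied by $\tilde\vartheta$) is globally exponentially stable, and the trajectories of the estimation errors $\tilde\vartheta(\cdot)$ converge exponentially to the origin.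
   Context: Frames and distances. $\mathscr C$ is a frame fixed to a moving monocular camera, $\mathscr G$ a frame fixed at a stationary goal. A stationary object has features $s_i$. The vectors $\underline p_c^{s_i}(t)$ (feature relative to camera), $\underline p_c^{g}(t)$ (goal relative to camera) and $\underline p_g^{s_i}$ (feature relative to goal, constant), all in $\mathbb R^3$, satisfy $\underline p_c^{g}(t)=\underline p_c^{s_i}(t)-R_c^g(t)\underline p_g^{s_i}$, where $R_c^g(t)$ is the rotation matrix giving the orientation of $\mathscr G$ with respect to $\mathscr C$. Write $\underline p_c^{s_i}=d_c^{s_i}\underline u_c^{s_i}$, $\underline p_c^{g}=d_c^{g}\underline u_c^{g}$, $\underline p_g^{s_i}=d_g^{s_i}\underline u_g^{s_i}$ with distances $d_c^{s_i}(t),d_c^{g}(t),d_g^{s_i}>0$ and unit vectors $\underline u_c^{s_i}(t),\underline u_c^g(t),\underline u_g^{s_i}$. Kinematics of the distances. With $\underline v_c(t)\in\mathbb R^3$ the (piecewise continuous) camera velocity expressed in $\mathscr C$, $\dot d_c^{s_i}(t)=-\underline u_c^{s_i}(t)^\top\underline v_c(t)$, $\dot d_c^{g}(t)=-\underline u_c^{g}(t)^\top\underline v_c(t)$, $\dot d_g^{s_i}=0$. Regressor. Let $H_{s_i}(t)=\begin{bmatrix}\underline u_c^{s_i}(t) & -\underline u_c^{g}(t)\end{bmatrix}\in\mathbb R^{3\times2}$. It is a standing assertion that $H_{s_i}^\top(t)H_{s_i}(t)$ is invertible while $d_c^g(t)>0$; set $Y_{s_i}(t)=\big(H_{s_i}^\top(t)H_{s_i}(t)\big)^{-1}H_{s_i}^\top(t)R_c^g(t)\underline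 u_g^{s_i}\in\mathbb R^{2}$, so that $\begin{bmatrix}d_c^{s_i}(t)\\ d_c^g(t)\end{bmatrix}=Y_{s_i}(t)d_g^{s_i}$. Integral data. Fix a delay $T>0$. Let $\mathcal Y_{s_i}(t)=0_{2\times1}$ and $\mathcal U_{s_i}(t)=0_{2\times 1}$ for $t\le T$, and for $t>T$ let $\mathcal Y_{s_i}(t)=Y_{s_i}(t)-Y_{s_i}(t-T)$ and $\mathcal U_{s_i}(t)=-\int_{t-T}^{t}\begin{bmatrix}\underline u_c^{s_i}(\sigma)^\top\\ \underline u_c^{g}(\sigma)^\top\end{bmatrix}\underline v_c(\sigma)\,d\sigma$. For an integer $N\ge1$ and (possibly time-varying) time instances $t_1(t),\dots,t_N(t)$, let $\Sigma_{\mathcal Y_{s_i}}(t)=\sum_{j=1}^N\mathcal Y_{s_i}^\top(t_j(t))\mathcal Y_{s_i}(t_j(t))$ and $\Sigma_{\mathcal U_{s_i}}(t)=\sum_{j=1}^N\mathcal Y_{s_i}^\top(t_j(t))\,\mathcal U_{s_i}(t_j(t))$. Finally, $\eta_{s_i}(t)=\begin{bmatrix}\eta_{s_i,1}(t)\\ \eta_{s_i,2}(t)\end{bmatrix}=-\begin{bmatrix}\underline u_c^{s_i}(t)^\top\\ \underline u_c^{g}(t)^\top\end{bmatrix}\underline v_c(t)$ and, for $t\ge\tau$, $\nu_{s_i}(t)=\begin{bmatrix}\nu_{s_i,1}(t)\\ \nu_{s_i,2}(t)\end{bmatrix}=Y_{s_i}(t)\Sigma_{\mathcal Y_{s_i}}^{-1}(t)\Sigma_{\mathcal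 U_{s_i}}(t)$. Assumptions. (i) For all $t\ge0$ at least four trackable planar features of the object are in the camera's field of view. (ii) The position $\underline p_g^{s_i}$ of the feature relative to the goal is known (in particular $\underline u_g^{s_i}$ is available). (iii) The camera's intrinsic matrix $A\in\mathbb R^{3\times3}$ is known and invertible. (Assumptions (i)–(iii) serve to make $R_c^g$, the unit vectors and hence $Y_{s_i}$ measurable.) (iv) Sufficient excitation: there exist constants $\tau>T$ and $\lambda_\tau>0$ such that $\lambda_{\min}\{\Sigma_{\mathcal Y_{s_i}}(t)\}>\lambda_\tau$ for all $t\ge\tau$, where $\lambda_{\min}$ is the minimum eigenvalue. The $\tau$ in the update laws is this $\tau$. Global exponential stability of the origin of a (time-varying) system means: there are constants $C,c>0$ such that every solution satisfies $\|\tilde\vartheta(t)\|\le C\|\tilde\vartheta(t_0)\|e^{-c(t-t_0)}$ for all $t\ge t_0\ge0$. *)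

theory Defs
  imports "HOL-Analysis.Analysis"
begin

text \<open>
  All signals live on the time axis \<open>t \<ge> 0\<close>; they are total functions whose values at
  negative times are irrelevant.
\<close>

definition locally_finite_times :: "real set \<Rightarrow> bool" where
  "locally_finite_times S \<longleftrightarrow> (\<forall>b. finite (S \<inter> {0..b}))"

definition piecewise_continuous :: "(real \<Rightarrow> 'a::topological_space) \<Rightarrow> bool" where
  "piecewise_continuous f \<longleftrightarrow>
     (\<exists>S. locally_finite_times S \<and>
          (\<forall>t\<in>{0..} - S. continuous (at t within {0..}) f) \<and>
          (\<forall>t\<in>{0..} \<inter> S. (\<exists>l. (f \<longlongrightarrow> l) (at_right t)) \<and>
                          (t > 0 \<longrightarrow> (\<exists>l. (f \<longlongrightarrow> l) (at_left t)))))"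

text \<open>
  Solutions of \<open>x' = f t x\<close> on \<open>[t\<^sub>0, \<infinity>)\<close>. The right-hand sides considered below jump (at the
  discontinuities of the velocity and at the switching time of the observer), so a solution is a
  continuous function that satisfies the differential equation off a locally finite set of times.
\<close>

definition is_solution ::
  "(real \<Rightarrow> 'a::real_normed_vector \<Rightarrow> 'a) \<Rightarrow> real \<Rightarrow> (real \<Rightarrow> 'a) \<Rightarrow> bool" where
  "is_solution f t0 x \<longleftrightarrow>
     continuous_on {t0..} x \<and>
     (\<exists>S. locally_finite_times S \<and>
          (\<forall>t\<in>{t0..} - S. (x has_vector_derivative f t (x t)) (at t within {t0..})))"

definition globally_exponentially_stable ::
  "(real \<Rightarrow> 'a::real_normed_vector \<Rightarrow> 'a) \<Rightarrow> bool" where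
  "globally_exponentially_stable f \<longleftrightarrow>
     (\<exists>C>0. \<exists>c>0. \<forall>t0\<ge>0. \<forall>x. is_solution f t0 x \<longrightarrow>
        (\<forall>t\<ge>t0. norm (x t) \<le> C * norm (x t0) * exp (- c * (t - t0))))"

definition lambda_min :: "real^'n^'n \<Rightarrow> real" where
  "lambda_min A = Min {l. \<exists>x. x \<noteq> 0 \<and> A *v x = l *\<^sub>R x}"

text \<open>
  The signals and constants available to the observer. Everything the update laws use is computed
  from this record; the distances themselves are not part of it.
    \<^item> \<open>dir_cs\<close>, \<open>dir_cg\<close>: directions of the feature and of the goal seen from the camera, in
      camera coordinates; \<open>dir_gs\<close>: direction of the feature seen from the goal, in goal coordinates.
    \<^item> \<open>rot\<close>: orientation of the goal frame with respect to the camera frame.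
    \<^item> \<open>vel\<close>: camera velocity in camera coordinates.
    \<^item> \<open>delay\<close>, \<open>samples\<close>, \<open>sample_time\<close>: the window length \<open>T\<close>, the number \<open>N\<close> and the
      instants \<open>t\<^sub>j(t)\<close>, \<open>j = 1, \<dots>, N\<close>, where \<open>sample_time j t\<close> is \<open>t\<^sub>j(t)\<close>.
\<close>

record observer_data =
  dir_cs :: "real \<Rightarrow> real^3"
  dir_cg :: "real \<Rightarrow> real^3"
  dir_gs :: "real^3"
  rot :: "real \<Rightarrow> real^3^3"
  vel :: "real \<Rightarrow> real^3"
  delay :: real
  samples :: nat
  sample_time :: "nat \<Rightarrow> real \<Rightarrow> real"

text \<open>\<open>H\<close> is the 3-by-2 matrix with the \<^emph>\<open>columns\<close> given below; \<open>vector\<close> lists rows.\<close>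

definition H_mat :: "observer_data \<Rightarrow> real \<Rightarrow> real^2^3" where
  "H_mat M t = transpose (vector [dir_cs M t, - dir_cg M t])"

definition regressor :: "observer_data \<Rightarrow> real \<Rightarrow> real^2" where
  "regressor M t =
     (matrix_inv (transpose (H_mat M t) ** H_mat M t) ** transpose (H_mat M t) ** rot M t) *v dir_gs M"

definition dir_rows :: "observer_data \<Rightarrow> real \<Rightarrow> real^3^2" where
  "dir_rows M t = vector [dir_cs M t, dir_cg M t]"

definition delayed_regressor :: "observer_data \<Rightarrow> real \<Rightarrow> real^2" where
  "delayed_regressor M t =
     (if t \<le> delay M then 0 else regressor M t - regressor M (t - delay M))"

definition delayed_input :: "observer_data \<Rightarrow> real \<Rightarrow> real^2" where
  "delayed_input M t =
     (if t \<le> delay M then 0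
      else - integral {t - delay M..t} (\<lambda>s. dir_rows M s *v vel M s))"

definition Sigma_Y :: "observer_data \<Rightarrow> real \<Rightarrow> real" where
  "Sigma_Y M t =
     (\<Sum>j=1..samples M. delayed_regressor M (sample_time M j t) \<bullet> delayed_regressor M (sample_time M j t))"

definition Sigma_U :: "observer_data \<Rightarrow> real \<Rightarrow> real" where
  "Sigma_U M t =
     (\<Sum>j=1..samples M. delayed_regressor M (sample_time M j t) \<bullet> delayed_input M (sample_time M j t))"

definition eta :: "observer_data \<Rightarrow> real \<Rightarrow> real^2" where
  "eta M t = - (dir_rows M t *v vel M t)"

definition nu :: "observer_data \<Rightarrow> real \<Rightarrow> real^2" where
  "nu M t = (inverse (Sigma_Y M t) * Sigma_U M t) *\<^sub>R regressor M t"

text \<open>\<open>Sigma_Y M t\<close> is a scalar; \<open>mat\<close> turns it into a 1-by-1 matrix.\<close>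

definition sufficiently_exciting :: "observer_data \<Rightarrow> real \<Rightarrow> real \<Rightarrow> bool" where
  "sufficiently_exciting M \<tau> lam \<longleftrightarrow>
     \<tau> > delay M \<and> lam > 0 \<and> (\<forall>t\<ge>\<tau>. lambda_min (mat (Sigma_Y M t) :: real^1^1) > lam)"

text \<open>Right-hand sides of the update laws at time \<open>t\<close>; \<open>z\<close> is the current estimate.\<close>

definition update_cs :: "observer_data \<Rightarrow> real \<Rightarrow> real \<Rightarrow> real \<Rightarrow> real \<Rightarrow> real" where
  "update_cs M \<tau> \<kappa>1 t z =
     (if t < \<tau> then eta M t $ 1 else eta M t $ 1 + \<kappa>1 * (nu M t $ 1 - z))"

definition update_cg :: "observer_data \<Rightarrow> real \<Rightarrow> real \<Rightarrow> real \<Rightarrow> real \<Rightarrow> real" where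
  "update_cg M \<tau> \<kappa>2 t z =
     (if t < \<tau> then eta M t $ 2 else eta M t $ 2 + \<kappa>2 * (nu M t $ 2 - z))"

definition update_gs :: "observer_data \<Rightarrow> real \<Rightarrow> real \<Rightarrow> real \<Rightarrow> real \<Rightarrow> real" where
  "update_gs M \<tau> \<kappa>3 t z =
     (if t < \<tau> then 0 else \<kappa>3 * (inverse (Sigma_Y M t) * Sigma_U M t - z))"

definition rate_cs :: "observer_data \<Rightarrow> real \<Rightarrow> real" where
  "rate_cs M t = - (dir_cs M t \<bullet> vel M t)"

definition rate_cg :: "observer_data \<Rightarrow> real \<Rightarrow> real" where
  "rate_cg M t = - (dir_cg M t \<bullet> vel M t)"

text \<open>
  The differential equation for the error \<open>e = d - z\<close>: the kinematics of the true distances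
  \<open>d = (d_cs, d_cg, d_gs)\<close> minus the update laws evaluated at the estimates \<open>z = d - e\<close>.
\<close>

definition error_system ::
  "observer_data \<Rightarrow> real \<Rightarrow> real \<Rightarrow> real \<Rightarrow> real \<Rightarrow> (real \<Rightarrow> real) \<Rightarrow> (real \<Rightarrow> real) \<Rightarrow> real
     \<Rightarrow> real \<Rightarrow> real^3 \<Rightarrow> real^3" where
  "error_system M \<tau> \<kappa>1 \<kappa>2 \<kappa>3 d_cs d_cg d_gs t e =
     vector [rate_cs M t - update_cs M \<tau> \<kappa>1 t (d_cs t - e $ 1),
             rate_cg M t - update_cg M \<tau> \<kappa>2 t (d_cg t - e $ 2),
             0 - update_gs M \<tau> \<kappa>3 t (d_gs - e $ 3)]"

definition estimation_error ::
  "(real \<Rightarrow> real) \<Rightarrow> (real \<Rightarrow> real) \<Rightarrow> real \<Rightarrow> (real \<Rightarrow> real) \<Rightarrow> (real \<Rightarrow> real) \<Rightarrow> (real \<Rightarrow> real)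
     \<Rightarrow> real \<Rightarrow> real^3" where
  "estimation_error d_cs d_cg d_gs est_cs est_cg est_gs t =
     vector [d_cs t - est_cs t, d_cg t - est_cg t, d_gs - est_gs t]"

text \<open>
  Pinhole model with optical axis along the third camera axis: a point with camera coordinates
  \<open>p\<close> has homogeneous pixel coordinates \<open>A p / p\<^sub>3\<close>. The field of view consists of the points in
  front of the camera whose pixel lies in the region \<open>Img\<close> covered by the image.
\<close>

definition field_of_view :: "real^3^3 \<Rightarrow> (real^3) set \<Rightarrow> (real^3) set" where
  "field_of_view A Img = {p. p $ 3 > 0 \<and> (1 / p $ 3) *\<^sub>R (A *v p) \<in> Img}"

text \<open>
  A feature is identified with its constant position \<open>q\<close> in the goal frame; its camera
  coordinates at time \<open>t\<close> are \<open>p_cg t + R t q\<close>. \<open>trackable t\<close> is the set of features that can be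
  tracked at time \<open>t\<close>.
\<close>

definition four_planar_features_visible ::
  "real^3^3 \<Rightarrow> (real^3) set \<Rightarrow> (real \<Rightarrow> real^3^3) \<Rightarrow> (real \<Rightarrow> real^3) \<Rightarrow> (real \<Rightarrow> (real^3) set) \<Rightarrow> bool"
  where
  "four_planar_features_visible A Img R p_cg trackable \<longleftrightarrow>
     (\<forall>t\<ge>0. \<exists>F \<subseteq> trackable t. card F \<ge> 4 \<and> coplanar F \<and>
        (\<forall>q\<in>F. p_cg t + R t *v q \<in> field_of_view A Img))"

end

theory Submission
  imports Defs
begin

text \<open>
  The regressor satisfies \<open>Y(t) d\<^sub>g = d(t)\<close>, so integrating the kinematics over the delay window gives
  \<open>\<Sigma>\<^sub>U = \<Sigma>\<^sub>Y d\<^sub>g\<close>. From \<open>\<tau>\<close> on, excitation makes \<open>\<Sigma>\<^sub>Y\<close> invertible and the observer feeds back the exact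
  distances. The error is therefore constant before \<open>\<tau>\<close> and each component obeys \<open>e' = - k e\<close> afterwards.
\<close>

section \<open>Calculus of solutions that obey their equation off a locally finite set of
  times\<close>

lemma locally_finite_times_insert:
  "locally_finite_times S \<Longrightarrow> locally_finite_times (insert x S)"
  unfolding locally_finite_times_def by (simp add: Int_insert_left)

lemma locally_finite_times_Un:
  "locally_finite_times S \<Longrightarrow> locally_finite_times S' \<Longrightarrow> locally_finite_times (S \<union> S')"
  unfolding locally_finite_times_def by (simp add: Int_Un_distrib2)

lemma is_solutionE:
  assumes "is_solution f t0 x"
  obtains S where "locally_finite_times S" "continuous_on {t0..} x"
    "\<And>t. t \<in> {t0..} - S \<Longrightarrow> (x has_vector_derivative f t (x t)) (at t within {t0..})"
  using assms unfolding is_solution_def by blast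

lemma is_solutionI:
  assumes "locally_finite_times S" "continuous_on {t0..} x"
    and "\<And>t. t \<in> {t0..} - S \<Longrightarrow> (x has_vector_derivative f t (x t)) (at t within {t0..})"
  shows "is_solution f t0 x"
  using assms unfolding is_solution_def by blast

text \<open>A bounded interval of nonnegative times meets only finitely many exceptional times, so
  continuity of \<open>x\<close> suffices for the fundamental theorem of calculus. Integrability of
  the right-hand side is part of the conclusion.\<close>

lemma is_solution_has_integral:
  fixes x :: "real \<Rightarrow> 'a::banach"
  assumes x: "is_solution f t0 x" and "0 \<le> t0" "t0 \<le> a" "a \<le> b"
  shows "((\<lambda>t. f t (x t)) has_integral (x b - x a)) {a..b}"
proof -
  obtain S where S: "locally_finite_times S" and cont: "continuous_on {t0..} x"
    and deriv: "\<And>t. t \<in> {t0..} - S \<Longrightarrow> (x has_vector_derivative f t (x t)) (at t within {t0..})"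
    using x by (rule is_solutionE) (rule that)
  show ?thesis
  proof (rule fundamental_theorem_of_calculus_interior_strong)
    show "finite (S \<inter> {0..b})"
      using S by (simp add: locally_finite_times_def)
    show "continuous_on {a..b} x"
      using cont by (rule continuous_on_subset) (use \<open>t0 \<le> a\<close> in auto)
    fix t assume t: "t \<in> {a<..<b} - S \<inter> {0..b}"
    \<comment> \<open>Inside the open interval the derivative relative to \<open>{t0..}\<close>
      becomes a two-sided one.\<close>
    have "(x has_vector_derivative f t (x t)) (at t within {a<..<b})"
      by (rule has_vector_derivative_within_subset[OF deriv]) (use t assms in auto)
    then show "(x has_vector_derivative f t (x t)) (at t)"
      using t at_within_open[of t "{a<..<b}"] by simp
  qed fact
qed

text \<open>Decouples a system whose \<open>i\<close>-th equation involves only the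
  \<open>i\<close>-th coordinate.\<close>

lemma is_solution_component:
  fixes x :: "real \<Rightarrow> real^'n"
  assumes x: "is_solution f t0 x"
    and f: "\<And>t e. t0 \<le> t \<Longrightarrow> f t e $ i = g t (e $ i)"
  shows "is_solution g t0 (\<lambda>t. x t $ i)"
proof -
  obtain S where S: "locally_finite_times S" and cont: "continuous_on {t0..} x"
    and deriv: "\<And>t. t \<in> {t0..} - S \<Longrightarrow> (x has_vector_derivative f t (x t)) (at t within {t0..})"
    using x by (rule is_solutionE) (rule that)
  have "((\<lambda>t. x t $ i) has_vector_derivative g t (x t $ i)) (at t within {t0..})"
    if "t \<in> {t0..} - S" for t
    using bounded_linear.has_vector_derivative[OF bounded_linear_vec_nth deriv[OF that], of i]
      f[of t "x t"] that by simp
  then show ?thesis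
    by (rule is_solutionI[OF S continuous_on_component[OF cont]])
qed

text \<open>A combination of fixed vectors is open to the continuity and derivative rules for sums
  and scalings.\<close>

lemma vector_3_eq_sum_axis:
  "(vector [a, b, c] :: real^3) = a *\<^sub>R axis 1 1 + b *\<^sub>R axis 2 1 + c *\<^sub>R axis 3 1"
  unfolding vec_eq_iff forall_3 by (simp add: axis_def)

text \<open>\<open>F\<close> is constrained only along the given trajectory, so it need not split
  into scalar equations elsewhere. The exceptional sets are merged.\<close>

lemma is_solution_vector_3:
  fixes x y z :: "real \<Rightarrow> real"
  assumes "is_solution f t0 x" "is_solution g t0 y" "is_solution h t0 z"
    and F: "\<And>t. t0 \<le> t \<Longrightarrow> F t (vector [x t, y t, z t]) = vector [f t (x t), g t (y t), h t (z t)]"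
  shows "is_solution F t0 (\<lambda>t. vector [x t, y t, z t] :: real^3)"
proof -
  obtain S1 where S1: "locally_finite_times S1" "continuous_on {t0..} x"
    "\<And>t. t \<in> {t0..} - S1 \<Longrightarrow> (x has_vector_derivative f t (x t)) (at t within {t0..})"
    using assms(1) by (rule is_solutionE) (rule that)
  obtain S2 where S2: "locally_finite_times S2" "continuous_on {t0..} y"
    "\<And>t. t \<in> {t0..} - S2 \<Longrightarrow> (y has_vector_derivative g t (y t)) (at t within {t0..})"
    using assms(2) by (rule is_solutionE) (rule that)
  obtain S3 where S3: "locally_finite_times S3" "continuous_on {t0..} z"
    "\<And>t. t \<in> {t0..} - S3 \<Longrightarrow> (z has_vector_derivative h t (z t)) (at t within {t0..})"
    using assms(3) by (rule is_solutionE) (rule that)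
  show ?thesis
  proof (rule is_solutionI)
    show "locally_finite_times (S1 \<union> S2 \<union> S3)"
      by (intro locally_finite_times_Un S1 S2 S3)
    show "continuous_on {t0..} (\<lambda>t. vector [x t, y t, z t] :: real^3)"
      unfolding vector_3_eq_sum_axis by (intro continuous_intros S1 S2 S3)
    fix t assume t: "t \<in> {t0..} - (S1 \<union> S2 \<union> S3)"
    then have "t0 \<le> t" by simp
    show "((\<lambda>t. vector [x t, y t, z t] :: real^3) has_vector_derivative F t (vector [x t, y t, z t]))
            (at t within {t0..})"
      unfolding F[OF \<open>t0 \<le> t\<close>] unfolding vector_3_eq_sum_axis
      by (intro has_vector_derivative_add S1(3) S2(3) S3(3)
          bounded_linear.has_vector_derivative[OF bounded_linear_scaleR_left]) (use t in auto)
  qed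
qed

lemma is_solution_diff:
  assumes "is_solution f t0 x" "is_solution g t0 y"
    and F: "\<And>t. t0 \<le> t \<Longrightarrow> F t (x t - y t) = f t (x t) - g t (y t)"
  shows "is_solution F t0 (\<lambda>t. x t - y t)"
proof -
  obtain S1 where S1: "locally_finite_times S1" "continuous_on {t0..} x"
    "\<And>t. t \<in> {t0..} - S1 \<Longrightarrow> (x has_vector_derivative f t (x t)) (at t within {t0..})"
    using assms(1) by (rule is_solutionE) (rule that)
  obtain S2 where S2: "locally_finite_times S2" "continuous_on {t0..} y"
    "\<And>t. t \<in> {t0..} - S2 \<Longrightarrow> (y has_vector_derivative g t (y t)) (at t within {t0..})"
    using assms(2) by (rule is_solutionE) (rule that)
  show ?thesis
  proof (rule is_solutionI)
    show "locally_finite_times (S1 \<union> S2)"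
      by (intro locally_finite_times_Un S1 S2)
    show "continuous_on {t0..} (\<lambda>t. x t - y t)"
      by (intro continuous_intros S1 S2)
    fix t assume t: "t \<in> {t0..} - (S1 \<union> S2)"
    then have "t0 \<le> t" by simp
    show "((\<lambda>t. x t - y t) has_vector_derivative F t (x t - y t)) (at t within {t0..})"
      unfolding F[OF \<open>t0 \<le> t\<close>]
      by (intro has_vector_derivative_diff S1(3) S2(3)) (use t in auto)
  qed
qed

lemma is_solution_const: "is_solution (\<lambda>_ _. 0) t0 (\<lambda>_. c)"
  by (rule is_solutionI[of "{}"]) (auto simp: locally_finite_times_def)

section \<open>Decay of linear systems that are switched on at a fixed time\<close>

lemma switched_decay:
  fixes y :: "real \<Rightarrow> real"
  assumes y: "is_solution (\<lambda>t z. if t < \<tau> then 0 else - k * z) t0 y" and "0 \<le> t0" "t0 \<le> t"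
  shows "y t = y t0 * exp (- k * (max t \<tau> - max t0 \<tau>))"
proof -
  \<comment> \<open>Integrating factor: \<open>max t \<tau>\<close> is frozen before \<tau> and
    grows like \<open>t\<close> afterwards, so \<open>?w\<close> is constant in both
    regimes.\<close>
  let ?w = "\<lambda>t. y t * exp (k * max t \<tau>)"
  obtain S where S: "locally_finite_times S" and cont: "continuous_on {t0..} y"
    and deriv: "\<And>t. t \<in> {t0..} - S \<Longrightarrow>
      (y has_vector_derivative (if t < \<tau> then 0 else - k * y t)) (at t within {t0..})"
    using y by (rule is_solutionE) (rule that)
  \<comment> \<open>The factor may have a kink at \<tau>, which therefore joins the exceptional set.
    Elsewhere \<open>max\<close> is resolved on a neighbourhood of \<open>t\<close> that stays on
    one side of \<tau>.\<close>
  have "(?w has_vector_derivative 0) (at t within {t0..})" if t: "t \<in> {t0..} - insert \<tau> S" for t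
  proof (cases "t < \<tau>")
    case True
    have "((\<lambda>t. y t * exp (k * \<tau>)) has_vector_derivative 0) (at t within {t0..})"
      using has_vector_derivative_mult_left[OF deriv[of t], of "exp (k * \<tau>)"] t True by auto
    then show ?thesis
      by (rule has_vector_derivative_transform_within[where d = "\<tau> - t"])
        (use t True in \<open>auto simp: dist_real_def max_def\<close>)
  next
    case False
    have "((\<lambda>t. y t * exp (k * t)) has_vector_derivative 0) (at t within {t0..})"
      using deriv[of t] t False unfolding has_real_derivative_iff_has_vector_derivative[symmetric]
      by (auto intro!: derivative_eq_intros)
    then show ?thesis
      by (rule has_vector_derivative_transform_within[where d = "t - \<tau>"])
        (use t False in \<open>auto simp: dist_real_def max_def\<close>)
  qed
  moreover have "continuous_on {t0..} ?w"
    by (intro continuous_intros cont)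
  ultimately have "is_solution (\<lambda>_ _. 0) t0 ?w"
    by (intro is_solutionI[OF locally_finite_times_insert[OF S]])
  from is_solution_has_integral[OF this \<open>0 \<le> t0\<close> order_refl \<open>t0 \<le> t\<close>]
  have "?w t = ?w t0"
    by (simp add: has_integral_0_eq)
  then show ?thesis
    by (simp add: right_diff_distrib exp_diff exp_minus field_simps)
qed

text \<open>Freezing the error on \<open>[0, \<tau>)\<close> costs the overshoot factor \<open>exp (c * \<tau>)\<close>.\<close>

lemma switched_linear_exponential_bound:
  fixes x :: "real \<Rightarrow> real^'n"
  assumes x: "is_solution f t0 x" and "0 \<le> t0" "t0 \<le> t" "0 \<le> \<tau>" "0 \<le> c"
    and k: "\<And>i. c \<le> k i"
    and f: "\<And>t e i. 0 \<le> t \<Longrightarrow> f t e $ i = (if t < \<tau> then 0 else - k i * e $ i)"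
  shows "norm (x t) \<le> exp (c * \<tau>) * norm (x t0) * exp (- c * (t - t0))"
proof -
  let ?K = "exp (c * \<tau> - c * (t - t0))"
  have "norm (x t $ i) \<le> norm ((?K *\<^sub>R x t0) $ i)" for i
  proof -
    have sol: "is_solution (\<lambda>t z. if t < \<tau> then 0 else - k i * z) t0 (\<lambda>t. x t $ i)"
      using x by (rule is_solution_component) (use f \<open>0 \<le> t0\<close> in simp)
    \<comment> \<open>\<open>max t \<tau>\<close> is at least \<open>t\<close>, and
      \<open>max t0 \<tau>\<close> is at most \<open>t0 + \<tau>\<close> since both summands are
      nonnegative.\<close>
    have "c * (t - t0 - \<tau>) \<le> c * (max t \<tau> - max t0 \<tau>)"
      using assms by (intro mult_left_mono) auto
    also have "\<dots> \<le> k i * (max t \<tau> - max t0 \<tau>)"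
      using k[of i] assms by (intro mult_right_mono) auto
    finally have "exp (- k i * (max t \<tau> - max t0 \<tau>)) \<le> ?K"
      by (simp add: algebra_simps)
    then show ?thesis
      unfolding switched_decay[OF sol \<open>0 \<le> t0\<close> \<open>t0 \<le> t\<close>]
      by (simp add: abs_mult mult.commute[of "\<bar>_\<bar>"] mult_right_mono del: exp_le_cancel_iff)
  qed
  then have "norm (x t) \<le> norm (?K *\<^sub>R x t0)"
    by (rule norm_le_componentwise_cart)
  then show ?thesis
    by (simp add: mult_exp_exp mult.commute mult.left_commute)
qed

section \<open>The regressor and the window integrals\<close>

lemma lambda_min_scalar: "lambda_min (mat a :: real^1^1) = a"
proof -
  \<comment> \<open>In dimension one every nonzero vector is an eigenvector for \<open>a\<close>, so
    \<open>Min\<close> is taken over a singleton.\<close>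
  have "{l. \<exists>x. x \<noteq> 0 \<and> (mat a :: real^1^1) *v x = l *\<^sub>R x} = {a}"
  proof -
    have "(\<exists>x. x \<noteq> 0 \<and> (mat a :: real^1^1) *v x = l *\<^sub>R x) \<longleftrightarrow> l = a" for l
    proof
      assume "l = a"
      then show "\<exists>x. x \<noteq> 0 \<and> (mat a :: real^1^1) *v x = l *\<^sub>R x"
        by (intro exI[of _ 1])
          (simp add: vec_eq_iff matrix_vector_mult_def mat_def)
    qed (auto simp: vec_eq_iff matrix_vector_mult_def mat_def)
    then show ?thesis by simp
  qed
  then show ?thesis
    by (simp add: lambda_min_def)
qed

lemma matrix_inv_mult_left:
  "invertible A \<Longrightarrow> matrix_inv A ** A = mat 1"
  unfolding invertible_def matrix_inv_def by (rule someI2_ex) auto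

lemma H_mat_mult: "H_mat M t *v vector [a, b] = a *\<^sub>R dir_cs M t - b *\<^sub>R dir_cg M t"
  by (simp add: H_mat_def vec_eq_iff matrix_vector_mult_def transpose_def sum_2 mult.commute)

text \<open>The second hypothesis reads \<open>H (a, b) = d R u\<close>, and the left inverse of
  \<open>H\<close> built into \<open>regressor\<close> recovers \<open>(a, b)\<close>.\<close>

lemma scaleR_regressor:
  assumes "invertible (transpose (H_mat M t) ** H_mat M t)"
    and "a *\<^sub>R dir_cs M t - b *\<^sub>R dir_cg M t = d *\<^sub>R (rot M t *v dir_gs M)"
  shows "d *\<^sub>R regressor M t = vector [a, b]"
proof -
  let ?H = "H_mat M t"
  let ?G = "transpose ?H ** ?H"
  have "d *\<^sub>R regressor M t = (matrix_inv ?G ** transpose ?H) *v (d *\<^sub>R (rot M t *v dir_gs M))"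
    by (simp add: regressor_def matrix_vector_mul_assoc matrix_vector_mult_scaleR)
  also have "\<dots> = (matrix_inv ?G ** transpose ?H) *v (?H *v vector [a, b])"
    by (simp add: H_mat_mult assms(2))
  also have "\<dots> = (matrix_inv ?G ** ?G) *v vector [a, b]"
    by (simp add: matrix_vector_mul_assoc matrix_mul_assoc)
  also have "\<dots> = vector [a, b]"
    by (simp add: matrix_inv_mult_left[OF assms(1)])
  finally show ?thesis .
qed

lemma dir_rows_mult: "dir_rows M t *v vel M t = - vector [rate_cs M t, rate_cg M t]"
  by (simp add: vec_eq_iff forall_2 dir_rows_def rate_cs_def rate_cg_def
      matrix_vector_mul_component)

lemma eta_eq: "eta M t = vector [rate_cs M t, rate_cg M t]"
  by (simp add: eta_def dir_rows_mult)

text \<open>Integrating the kinematics over the window gives \<open>\<U>(t) = d(t) - d(t - T) = \<Y>(t) d\<^sub>g\<close>.\<close>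

lemma delayed_input_eq:
  assumes "delay M \<ge> 0"
    and cs: "is_solution (\<lambda>t _. rate_cs M t) 0 d_cs"
    and cg: "is_solution (\<lambda>t _. rate_cg M t) 0 d_cg"
    and Y: "\<And>t. t \<ge> 0 \<Longrightarrow> d *\<^sub>R regressor M t = vector [d_cs t, d_cg t]"
  shows "delayed_input M t = d *\<^sub>R delayed_regressor M t"
proof (cases "t \<le> delay M")
  case False
  let ?a = "t - delay M"
  have le: "0 \<le> ?a" "?a \<le> t" using False assms(1) by auto
  \<comment> \<open>The integrand is the vector of distance rates, so each component integrates to
    the change of one distance over the window.\<close>
  have "((\<lambda>s. - (dir_rows M s *v vel M s)) has_integral (vector [d_cs t, d_cg t] - vector [d_cs ?a, d_cg ?a]))
          {?a..t}"
    using is_solution_has_integral[OF cs order_refl le] is_solution_has_integral[OF cg order_refl le]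
    by (subst has_integral_componentwise_iff)
      (auto simp: dir_rows_mult Basis_vec_def inner_axis forall_2)
  then have "delayed_input M t = vector [d_cs t, d_cg t] - vector [d_cs ?a, d_cg ?a]"
    using False by (simp add: delayed_input_def has_integral_neg_iff integral_unique
        flip: integral_neg)
  then show ?thesis
    using False le Y[of t] Y[of ?a]
    by (simp add: delayed_regressor_def scaleR_diff_right)
\<comment> \<open>Up to time \<open>delay M\<close> both sides have the default value 0. The
  identity thus holds at every real time, whatever the sampling instants are.\<close>
qed (simp add: delayed_input_def delayed_regressor_def)

text \<open>\<open>eta\<close> cancels the true rates. From \<tau> on, the feedback targets equal
  the true distances, so at the estimate \<open>d - e\<close> each correction is the gain times the
  error. This is the form that \<open>switched_linear_exponential_bound\<close> asks for.\<close>

lemma error_system_component: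
  assumes "delay M \<ge> 0"
    and cs: "is_solution (\<lambda>t _. rate_cs M t) 0 d_cs"
    and cg: "is_solution (\<lambda>t _. rate_cg M t) 0 d_cg"
    and Y: "\<And>t. t \<ge> 0 \<Longrightarrow> d *\<^sub>R regressor M t = vector [d_cs t, d_cg t]"
    and excitation: "sufficiently_exciting M \<tau> lam"
    and "t \<ge> 0"
  shows "error_system M \<tau> \<kappa>1 \<kappa>2 \<kappa>3 d_cs d_cg d t e $ i =
         (if t < \<tau> then 0 else - (vector [\<kappa>1, \<kappa>2, \<kappa>3] :: real^3) $ i * e $ i)"
proof (cases "t < \<tau>")
  case True
  then show ?thesis
    using exhaust_3[of i]
    by (auto simp: error_system_def update_cs_def update_cg_def update_gs_def eta_eq)
next
  case False
  \<comment> \<open>The minimum eigenvalue of the 1-by-1 matrix is \<open>Sigma_Y M t\<close>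
    itself, which exceeds \<open>lam > 0\<close>.\<close>
  have "Sigma_Y M t > 0"
    using excitation False
    by (auto simp: sufficiently_exciting_def lambda_min_scalar intro: order_less_trans)
  moreover have "Sigma_U M t = d * Sigma_Y M t"
    by (simp add: Sigma_U_def Sigma_Y_def delayed_input_eq[OF assms(1) cs cg Y] sum_distrib_left)
  ultimately have d: "inverse (Sigma_Y M t) * Sigma_U M t = d"
    by simp
  then have "nu M t = vector [d_cs t, d_cg t]"
    using Y[OF \<open>t \<ge> 0\<close>] by (simp add: nu_def)
  with d False show ?thesis
    using exhaust_3[of i]
    by (auto simp: error_system_def update_cs_def update_cg_def update_gs_def eta_eq)
qed

theorem theorem1:
  fixes M :: observer_data
    and p_cs p_cg :: "real \<Rightarrow> real^3" and p_gs :: "real^3"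
    and d_cs d_cg :: "real \<Rightarrow> real" and d_gs :: real
    and features :: "(real^3) set" and trackable :: "real \<Rightarrow> (real^3) set"
    and A :: "real^3^3" and Img :: "(real^3) set"
    and \<tau> lam \<kappa>1 \<kappa>2 \<kappa>3 :: real
    and est_cs est_cg est_gs :: "real \<Rightarrow> real"
  assumes rotation: "\<And>t. t \<ge> 0 \<Longrightarrow> rotation_matrix (rot M t)"
    and goal_position: "\<And>t. t \<ge> 0 \<Longrightarrow> p_cg t = p_cs t - rot M t *v p_gs"
    and polar_cs: "\<And>t. t \<ge> 0 \<Longrightarrow> p_cs t = d_cs t *\<^sub>R dir_cs M t \<and> d_cs t > 0 \<and> norm (dir_cs M t) = 1"
    and polar_cg: "\<And>t. t \<ge> 0 \<Longrightarrow> p_cg t = d_cg t *\<^sub>R dir_cg M t \<and> d_cg t > 0 \<and> norm (dir_cg M t) = 1"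
    and polar_gs: "p_gs = d_gs *\<^sub>R dir_gs M \<and> d_gs > 0 \<and> norm (dir_gs M) = 1"
    and velocity: "piecewise_continuous (vel M)"
    and kinematics_cs: "is_solution (\<lambda>t _. rate_cs M t) 0 d_cs"
    and kinematics_cg: "is_solution (\<lambda>t _. rate_cg M t) 0 d_cg"
    and regressor_wd: "\<And>t. t \<ge> 0 \<Longrightarrow> d_cg t > 0 \<Longrightarrow> invertible (transpose (H_mat M t) ** H_mat M t)"
    and delay: "delay M > 0"
    and samples: "samples M \<ge> 1"
    and feature: "p_gs \<in> features"
    and trackable: "\<And>t. t \<ge> 0 \<Longrightarrow> trackable t \<subseteq> features"
    and visible: "four_planar_features_visible A Img (rot M) p_cg trackable"
    and intrinsic: "invertible A"
    and excitation: "sufficiently_exciting M \<tau> lam"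
    and gains: "\<kappa>1 > 0" "\<kappa>2 > 0" "\<kappa>3 > 0"
    and observer_cs: "is_solution (update_cs M \<tau> \<kappa>1) 0 est_cs"
    and observer_cg: "is_solution (update_cg M \<tau> \<kappa>2) 0 est_cg"
    and observer_gs: "is_solution (update_gs M \<tau> \<kappa>3) 0 est_gs"
  shows "globally_exponentially_stable (error_system M \<tau> \<kappa>1 \<kappa>2 \<kappa>3 d_cs d_cg d_gs) \<and>
         (let err = estimation_error d_cs d_cg d_gs est_cs est_cg est_gs in
            is_solution (error_system M \<tau> \<kappa>1 \<kappa>2 \<kappa>3 d_cs d_cg d_gs) 0 err \<and>
            (\<exists>C>0. \<exists>c>0. \<forall>t\<ge>0. norm (err t) \<le> C * norm (err 0) * exp (- c * t)))"
proof -
  let ?F = "error_system M \<tau> \<kappa>1 \<kappa>2 \<kappa>3 d_cs d_cg d_gs"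
  let ?err = "estimation_error d_cs d_cg d_gs est_cs est_cg est_gs"
  \<comment> \<open>The slowest of the three gains is a decay rate common to all components.\<close>
  define c where "c = min \<kappa>1 (min \<kappa>2 \<kappa>3)"
  have c: "c > 0" using gains by (simp add: c_def)
  have \<tau>: "\<tau> \<ge> 0" using excitation delay by (simp add: sufficiently_exciting_def)
  have Y: "d_gs *\<^sub>R regressor M t = vector [d_cs t, d_cg t]" if "t \<ge> 0" for t
  proof (rule scaleR_regressor)
    show "invertible (transpose (H_mat M t) ** H_mat M t)"
      using regressor_wd polar_cg that by blast
    have "p_cs t - p_cg t = rot M t *v p_gs"
      using goal_position[OF that] by simp
    then show "d_cs t *\<^sub>R dir_cs M t - d_cg t *\<^sub>R dir_cg M t = d_gs *\<^sub>R (rot M t *v dir_gs M)"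
      using polar_cs[OF that] polar_cg[OF that] polar_gs by (simp add: matrix_vector_mult_scaleR)
  qed
  \<comment> \<open>The constants depend neither on the solution nor on \<open>t0\<close>. The bound
    serves both the stability claim and, with \<open>t0 = 0\<close>, the actual estimation
    error.\<close>
  have bound: "norm (x t) \<le> exp (c * \<tau>) * norm (x t0) * exp (- c * (t - t0))"
    if "is_solution ?F t0 x" "0 \<le> t0" "t0 \<le> t" for t0 t x
  proof (rule switched_linear_exponential_bound[OF that \<tau>])
    show "c \<le> (vector [\<kappa>1, \<kappa>2, \<kappa>3] :: real^3) $ i" for i
      using exhaust_3[of i] by (auto simp: c_def)
  qed (use c delay error_system_component[OF _ kinematics_cs kinematics_cg Y excitation] in auto)
  \<comment> \<open>The true distances solve the kinematics, with \<open>d_gs\<close> as a constant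
    solution. Subtracting the update laws gives \<open>error_system\<close>, because
    \<open>d - e\<close> is the estimate along this trajectory.\<close>
  have sol: "is_solution ?F 0 ?err"
    unfolding estimation_error_def[abs_def]
    by (rule is_solution_vector_3[OF
          is_solution_diff[OF kinematics_cs observer_cs]
          is_solution_diff[OF kinematics_cg observer_cg]
          is_solution_diff[OF is_solution_const observer_gs]])
      (auto simp: error_system_def)
  have "globally_exponentially_stable ?F"
    unfolding globally_exponentially_stable_def
    using bound c by (intro exI[of _ "exp (c * \<tau>)"] exI[of _ c] conjI) auto
  moreover have "\<exists>C>0. \<exists>c>0. \<forall>t\<ge>0. norm (?err t) \<le> C * norm (?err 0) * exp (- c * t)"
    using bound[OF sol] c by (intro exI[of _ "exp (c * \<tau>)"] exI[of _ c] conjI) auto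
  ultimately show ?thesis
    using sol by (simp add: Let_def)
qed

end
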